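(* Let $(X,[\cdot,\cdot]_X)$ and $(Y,[\cdot,\cdot]_Y)$ be Krein spaces and let $V:X\to Y$ be an isometric linear relation. Let $M:=\operatorname{dom}V\cap(\operatorname{dom}V)^{[\perp]_X}$ and $\tilde M:=\operatorname{ran}V\cap(\operatorname{ran}V)^{[\perp]_Y}$ be the isotropic manifolds of $\operatorname{dom}V$ and $\operatorname{ran}V$. Then: (i) $\tilde M=\operatorname{mul}V$ if and only if $M=\ker V$. (ii) If $\operatorname{dom}V\subseteq X$ is closed and $\overline{\operatorname{ran}V}=Y$, then $V$ is a bounded operator. (iii) If either ($\overline{\operatorname{dom}V}=X$ and $\operatorname{ran}V=Y$) or ($\overline{\operatorname{ran}V}=Y$ and $\operatorname{dom}V=X$) holds, then $V$ is a standard unitary operator.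
   Context: Krein spaces carry the topology of an associated Hilbert space. A linear relation $V:X\to Y$ is a linear subspace $V\subseteq X\times Y$, with $\operatorname{dom}V=\{x:(x,y)\in V\text{ for some }y\}$, $\operatorname{ran}V=\{y:(x,y)\in V\text{ for some }x\}$, $\ker V=\{x:(x,0)\in V\}$, $\operatorname{mul}V=\{y:(0,y)\in V\}$; $V$ is an operator (single-valued) if $\operatorname{mul}V=\{0\}$. The relation $V$ is isometric if $V^{-1}\subseteq V^*$, where $V^{-1}=\{(y,x):(x,y)\in V\}$ and $V^*=\{(k,h)\in Y\times X:[f,h]_X=[g,k]_Y\ \forall(f,g)\in V\}$; equivalently $[f',g']_Y=[f,g]_X$ for all $(f,f'),(g,g')\in V$. A standard unitary operator is an isometric operator $V:X\to Y$ with $\operatorname{dom}V=X$ and $\operatorname{ran}V=Y$. $A^{[\perp]}$ denotes the orthogonal companion of $A$. *)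

theory Defs
  imports "HOL-Analysis.Analysis"
begin

text \<open>
  A Krein space is given by a complex vector space whose carrier is a whole type, with scalar
  multiplication \<open>s\<close>, and an indefinite inner product \<open>ip\<close>, linear in the first argument.
\<close>

definition form_dist :: "('a \<Rightarrow> 'a \<Rightarrow> complex) \<Rightarrow> 'a::ab_group_add \<Rightarrow> 'a \<Rightarrow> real" where
  "form_dist ip x y = sqrt (cmod (ip (x - y) (x - y)))"

text \<open>
  The last two conjuncts, together with definiteness, say that \<open>P\<close> with \<open>ip\<close> and \<open>N\<close> with
  \<open>- ip\<close> are Hilbert spaces: on either of them \<^term>\<open>form_dist ip\<close> is the distance of the definite
  inner product.
\<close>

definition fundamental_decomposition ::
  "(complex \<Rightarrow> 'a \<Rightarrow> 'a) \<Rightarrow> ('a \<Rightarrow> 'a \<Rightarrow> complex) \<Rightarrow> 'a::ab_group_add set \<Rightarrow> 'a set \<Rightarrow> bool" where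
  "fundamental_decomposition s ip P N \<longleftrightarrow>
     module.subspace s P \<and> module.subspace s N \<and>
     P \<inter> N = {0} \<and> (\<forall>x. \<exists>p\<in>P. \<exists>n\<in>N. x = p + n) \<and>
     (\<forall>p\<in>P. \<forall>n\<in>N. ip p n = 0) \<and>
     (\<forall>p\<in>P. p \<noteq> 0 \<longrightarrow> 0 < Re (ip p p)) \<and>
     (\<forall>n\<in>N. n \<noteq> 0 \<longrightarrow> Re (ip n n) < 0) \<and>
     Metric_space.mcomplete P (form_dist ip) \<and>
     Metric_space.mcomplete N (form_dist ip)"

locale krein_space = vector_space s
  for s :: "complex \<Rightarrow> 'a::ab_group_add \<Rightarrow> 'a" +
  fixes ip :: "'a \<Rightarrow> 'a \<Rightarrow> complex"
  assumes ip_add_left: "ip (x + y) z = ip x z + ip y z"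
    and ip_scale_left: "ip (s c x) y = c * ip x y"
    and ip_commute: "ip y x = cnj (ip x y)"
    and ex_fundamental_decomposition: "\<exists>P N. fundamental_decomposition s ip P N"

definition fundamental_symmetry :: "'a::ab_group_add set \<Rightarrow> 'a set \<Rightarrow> 'a \<Rightarrow> 'a" where
  "fundamental_symmetry P N x = (THE j. \<exists>p\<in>P. \<exists>n\<in>N. x = p + n \<and> j = p - n)"

text \<open>
  The norm of the Hilbert space associated with a fundamental decomposition. Different
  decompositions give equivalent norms, so topological notions stated for one of them are
  those of the Krein space.
\<close>

definition hilbert_norm ::
  "('a \<Rightarrow> 'a \<Rightarrow> complex) \<Rightarrow> 'a::ab_group_add set \<Rightarrow> 'a set \<Rightarrow> 'a \<Rightarrow> real" where
  "hilbert_norm ip P N x = sqrt (Re (ip (fundamental_symmetry P N x) x))"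

definition hilbert_topology ::
  "('a \<Rightarrow> 'a \<Rightarrow> complex) \<Rightarrow> 'a::ab_group_add set \<Rightarrow> 'a set \<Rightarrow> 'a topology" where
  "hilbert_topology ip P N =
     Metric_space.mtopology UNIV (\<lambda>x y. hilbert_norm ip P N (x - y))"

definition orth_companion :: "('a \<Rightarrow> 'a \<Rightarrow> complex) \<Rightarrow> 'a set \<Rightarrow> 'a set" where
  "orth_companion ip A = {x. \<forall>a\<in>A. ip x a = 0}"

definition isotropic_part :: "('a \<Rightarrow> 'a \<Rightarrow> complex) \<Rightarrow> 'a set \<Rightarrow> 'a set" where
  "isotropic_part ip A = A \<inter> orth_companion ip A"

text \<open>The domain and range of a relation are \<^const>\<open>Domain\<close> and \<^const>\<open>Range\<close>.\<close>

definition linear_relation ::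
  "(complex \<Rightarrow> 'a \<Rightarrow> 'a) \<Rightarrow> (complex \<Rightarrow> 'b \<Rightarrow> 'b) \<Rightarrow>
   ('a::ab_group_add \<times> 'b::ab_group_add) set \<Rightarrow> bool" where
  "linear_relation sX sY V \<longleftrightarrow> module.subspace (module_prod.scale sX sY) V"

definition ker_rel :: "('a \<times> 'b::zero) set \<Rightarrow> 'a set" where
  "ker_rel V = {x. (x, 0) \<in> V}"

definition mul_rel :: "('a::zero \<times> 'b) set \<Rightarrow> 'b set" where
  "mul_rel V = {y. (0, y) \<in> V}"

definition is_operator :: "('a::zero \<times> 'b::zero) set \<Rightarrow> bool" where
  "is_operator V \<longleftrightarrow> mul_rel V = {0}"

definition adjoint_rel ::
  "('a \<Rightarrow> 'a \<Rightarrow> complex) \<Rightarrow> ('b \<Rightarrow> 'b \<Rightarrow> complex) \<Rightarrow> ('a \<times> 'b) set \<Rightarrow> ('b \<times> 'a) set" where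
  "adjoint_rel ipX ipY V = {(k, h). \<forall>(f, g)\<in>V. ipX f h = ipY g k}"

definition isometric_rel ::
  "('a \<Rightarrow> 'a \<Rightarrow> complex) \<Rightarrow> ('b \<Rightarrow> 'b \<Rightarrow> complex) \<Rightarrow> ('a \<times> 'b) set \<Rightarrow> bool" where
  "isometric_rel ipX ipY V \<longleftrightarrow> V\<inverse> \<subseteq> adjoint_rel ipX ipY V"

definition bounded_operator ::
  "('a \<Rightarrow> real) \<Rightarrow> ('b \<Rightarrow> real) \<Rightarrow> ('a::zero \<times> 'b::zero) set \<Rightarrow> bool" where
  "bounded_operator normX normY V \<longleftrightarrow>
     is_operator V \<and> (\<exists>C. \<forall>(x, y)\<in>V. normY y \<le> C * normX x)"

definition standard_unitary ::
  "(complex \<Rightarrow> 'a \<Rightarrow> 'a) \<Rightarrow> ('a \<Rightarrow> 'a \<Rightarrow> complex) \<Rightarrow> (complex \<Rightarrow> 'b \<Rightarrow> 'b) \<Rightarrow>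
   ('b \<Rightarrow> 'b \<Rightarrow> complex) \<Rightarrow> ('a::ab_group_add \<times> 'b::ab_group_add) set \<Rightarrow> bool" where
  "standard_unitary sX ipX sY ipY V \<longleftrightarrow>
     linear_relation sX sY V \<and> isometric_rel ipX ipY V \<and> is_operator V \<and>
     Domain V = UNIV \<and> Range V = UNIV"

end

theory Submission
  imports Defs
begin

text \<open>
  If \<open>(x, y)\<close> belongs to the isometric relation \<open>V\<close>, then \<open>x\<close> is orthogonal to the domain exactly
  when \<open>y\<close> is orthogonal to the range. So \<open>V\<close> matches the isotropic vectors of its domain with
  those of its range (\<open>isotropic_iff\<close>). If the former are just the kernel, then an isotropic \<open>y\<close>
  comes from some \<open>x\<close> with \<open>(x, 0) \<in> V\<close>, and subtracting gives \<open>(0, y) \<in> V\<close>. The converse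
  implication is the same argument for \<open>V\<inverse>\<close>, which is isometric as well.

  A dense range has no isotropic vectors except \<open>0\<close>, so \<open>V\<close> is then single-valued. For boundedness
  on a closed domain, write \<open>\<parallel>y\<parallel>\<close> for \<open>(x, y) \<in> V\<close> as the supremum of \<open>\<bar>[y, w]\<bar>\<close> over the \<open>w\<close> of
  norm at most one in the dense range (\<open>nrm_le_by_dense\<close>). For \<open>(z, w) \<in> V\<close> isometry turns
  \<open>[y, w]\<close> into \<open>[x, z]\<close>, which is continuous in \<open>x\<close> and, for fixed \<open>x\<close>, bounded by \<open>\<parallel>y\<parallel>\<close>. The
  uniform boundedness principle (\<open>uniform_boundedness\<close>), valid because a closed domain is complete,
  makes the bound uniform on bounded sets of \<open>x\<close>. This replaces the closed graph theorem, so no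
  closure of \<open>V\<close> has to be formed.

  Suppose finally that the domain is everything and the range is dense, and let \<open>C\<close> bound \<open>V\<close>. With
  the fundamental symmetry \<open>J\<close> one has \<open>\<parallel>x\<parallel>\<^sup>2 = [x, J x] = [V x, V (J x)] \<le> C \<parallel>V x\<parallel> \<parallel>x\<parallel>\<close>, so \<open>V\<close> is
  also bounded below. Its range is therefore closed, hence everything
  (\<open>Range_UNIV_if_Domain_UNIV\<close>). The remaining case, dense domain and full range, is this one
  applied to \<open>V\<inverse>\<close>.
\<close>

section \<open>The Hilbert space associated with a fundamental decomposition\<close>

locale decomposed_krein_space = krein_space s ip
  for s :: "complex \<Rightarrow> 'a::ab_group_add \<Rightarrow> 'a" and ip +
  fixes P N :: "'a set"
  assumes decomposition: "fundamental_decomposition s ip P N"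
begin

abbreviation J :: "'a \<Rightarrow> 'a" where "J \<equiv> fundamental_symmetry P N"
abbreviation nrm :: "'a \<Rightarrow> real" where "nrm \<equiv> hilbert_norm ip P N"

lemma ip_add_right: "ip x (y + z) = ip x y + ip x z"
  by (metis complex_cnj_add ip_add_left ip_commute)

lemma ip_scale_right: "ip x (s c y) = cnj c * ip x y"
  by (metis complex_cnj_mult ip_scale_left ip_commute)

lemma ip_zero_left [simp]: "ip 0 x = 0"
  using ip_add_left[of 0 0 x] by simp

lemma ip_zero_right [simp]: "ip x 0 = 0"
  using ip_add_right[of x 0 0] by simp

lemma ip_minus_left: "ip (- x) y = - ip x y"
  using ip_add_left[of "- x" x y] by (simp add: eq_neg_iff_add_eq_0)

lemma ip_minus_right: "ip x (- y) = - ip x y"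
  using ip_add_right[of x "- y" y] by (simp add: eq_neg_iff_add_eq_0)

lemma ip_diff_left: "ip (x - y) z = ip x z - ip y z"
  using ip_add_left[of x "- y" z] by (simp add: ip_minus_left)

lemma ip_diff_right: "ip x (y - z) = ip x y - ip x z"
  using ip_add_right[of x y "- z"] by (simp add: ip_minus_right)

lemma subspace_P: "subspace P" and subspace_N: "subspace N"
  and P_Int_N: "P \<inter> N = {0}"
  and P_N_orth: "p \<in> P \<Longrightarrow> n \<in> N \<Longrightarrow> ip p n = 0"
  and P_pos: "p \<in> P \<Longrightarrow> p \<noteq> 0 \<Longrightarrow> 0 < Re (ip p p)"
  and N_neg: "n \<in> N \<Longrightarrow> n \<noteq> 0 \<Longrightarrow> Re (ip n n) < 0"
  and mcomplete_P: "Metric_space.mcomplete P (form_dist ip)"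
  and mcomplete_N: "Metric_space.mcomplete N (form_dist ip)"
  using decomposition unfolding fundamental_decomposition_def by auto

lemma N_P_orth: "n \<in> N \<Longrightarrow> p \<in> P \<Longrightarrow> ip n p = 0"
  using ip_commute[of n p] P_N_orth by simp

lemma decomposeE:
  obtains p n where "p \<in> P" "n \<in> N" "x = p + n"
  using decomposition unfolding fundamental_decomposition_def by metis

lemma J_eq:
  assumes "p \<in> P" "n \<in> N"
  shows "J (p + n) = p - n"
  unfolding fundamental_symmetry_def
proof (rule the_equality)
  show "\<exists>p'\<in>P. \<exists>n'\<in>N. p + n = p' + n' \<and> p - n = p' - n'"
    using assms by blast
next
  fix j assume "\<exists>p'\<in>P. \<exists>n'\<in>N. p + n = p' + n' \<and> j = p' - n'"
  then obtain p' n' where *: "p' \<in> P" "n' \<in> N" "p + n = p' + n'" "j = p' - n'"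
    by blast
  have eq: "p - p' = n' - n"
    using *(3) by (simp add: algebra_simps)
  have "p - p' \<in> P \<inter> N"
    using subspace_diff[OF subspace_P assms(1) *(1)] subspace_diff[OF subspace_N *(2) assms(2)] eq
    by simp
  then have "p - p' = 0"
    using P_Int_N by blast
  with eq show "j = p - n"
    using *(4) by simp
qed

lemma J_add: "J (x + y) = J x + J y"
proof -
  obtain p n where x: "p \<in> P" "n \<in> N" "x = p + n" by (rule decomposeE)
  obtain q m where y: "q \<in> P" "m \<in> N" "y = q + m" by (rule decomposeE)
  have "J ((p + q) + (n + m)) = (p + q) - (n + m)"
    by (intro J_eq subspace_add subspace_P subspace_N x y)
  moreover have "x + y = (p + q) + (n + m)"
    by (simp add: x y algebra_simps)
  moreover have "J x = p - n" "J y = q - m"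
    unfolding x(3) y(3) by (intro J_eq x y)+
  ultimately show ?thesis
    by (simp only: add_diff_add)
qed

lemma J_scale: "J (s c x) = s c (J x)"
proof -
  obtain p n where x: "p \<in> P" "n \<in> N" "x = p + n" by (rule decomposeE)
  have "J (s c p + s c n) = s c p - s c n"
    by (intro J_eq subspace_scale subspace_P subspace_N x)
  then show ?thesis
    by (simp add: x J_eq scale_right_distrib scale_right_diff_distrib)
qed

lemma J_diff: "J (x - y) = J x - J y"
  using J_add[of "x - y" y] by simp

lemma J_J [simp]: "J (J x) = x"
proof -
  obtain p n where x: "p \<in> P" "n \<in> N" "x = p + n" by (rule decomposeE)
  have "J (p + - n) = p - - n"
    by (intro J_eq subspace_neg subspace_N x)
  then show ?thesis
    by (simp add: x J_eq)
qed

lemma ip_J_commute: "ip (J x) y = ip x (J y)"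
proof -
  obtain p n where x: "p \<in> P" "n \<in> N" "x = p + n" by (rule decomposeE)
  obtain q m where y: "q \<in> P" "m \<in> N" "y = q + m" by (rule decomposeE)
  show ?thesis
    by (simp add: x y J_eq ip_add_left ip_add_right ip_diff_left ip_diff_right P_N_orth N_P_orth)
qed

lemma ip_J_decomposed:
  assumes "p \<in> P" "n \<in> N"
  shows "ip (J (p + n)) (p + n) = ip p p - ip n n"
  using assms by (simp add: J_eq ip_add_right ip_diff_left P_N_orth N_P_orth)

lemma ip_J_self_pos:
  assumes "x \<noteq> 0"
  shows "0 < Re (ip (J x) x)"
proof -
  obtain p n where x: "p \<in> P" "n \<in> N" "x = p + n" by (rule decomposeE)
  have "0 < Re (ip p p) - Re (ip n n)"
    using P_pos[OF x(1)] N_neg[OF x(2)] assms x(3) by (cases "p = 0"; cases "n = 0") simp_all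
  then show ?thesis
    by (simp add: x(3) ip_J_decomposed[OF x(1,2)])
qed

lemma nrm_zero [simp]: "nrm 0 = 0"
  by (simp add: hilbert_norm_def)

lemma nrm_sq: "(nrm x)\<^sup>2 = Re (ip (J x) x)"
  using ip_J_self_pos[of x] by (cases "x = 0") (simp_all add: hilbert_norm_def)

lemma nrm_pos: "x \<noteq> 0 \<Longrightarrow> 0 < nrm x"
  by (simp add: hilbert_norm_def ip_J_self_pos)

lemma nrm_nonneg [simp]: "0 \<le> nrm x"
  using nrm_pos[of x] by (cases "x = 0") auto

lemma nrm_eq_0_iff [simp]: "nrm x = 0 \<longleftrightarrow> x = 0"
  using nrm_pos[of x] by (cases "x = 0") simp_all

lemma ip_J_self: "ip (J x) x = complex_of_real ((nrm x)\<^sup>2)"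
proof -
  have "ip (J x) x = cnj (ip (J x) x)"
    using ip_commute[of "J x" x] ip_J_commute[of x x] by simp
  then have "Im (ip (J x) x) = 0"
    by (metis cnj.simps(2) neg_equal_zero)
  then show ?thesis
    by (simp add: nrm_sq complex_eq_iff)
qed

lemma nrm_J [simp]: "nrm (J x) = nrm x"
  by (simp add: hilbert_norm_def ip_J_commute)

lemma nrm_scale: "nrm (s c x) = cmod c * nrm x"
proof -
  have "ip (J (s c x)) (s c x) = (c * cnj c) * ip (J x) x"
    by (simp add: J_scale ip_scale_left ip_scale_right mult.assoc)
  also have "\<dots> = complex_of_real ((cmod c * nrm x)\<^sup>2)"
    by (simp only: complex_norm_square[symmetric] ip_J_self power_mult_distrib of_real_mult)
  finally have "(nrm (s c x))\<^sup>2 = (cmod c * nrm x)\<^sup>2"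
    by (simp only: nrm_sq Re_complex_of_real)
  then show ?thesis
    by (simp add: power2_eq_iff_nonneg)
qed

lemma nrm_minus: "nrm (- x) = nrm x"
  using nrm_scale[of "- 1" x] by simp

text \<open>
  The positive definite form \<open>ip (J x) y\<close> satisfies the Cauchy--Schwarz inequality, and \<open>J\<close> is an
  isometric involution for its norm, so the indefinite form inherits the estimate.
\<close>

lemma Cauchy_Schwarz_ip: "cmod (ip x y) \<le> nrm x * nrm y"
proof -
  have main: "cmod (ip (J u) v) \<le> nrm u * nrm v" for u v
  proof (cases "u = 0")
    case False
    define a where "a = ip (J u) v"
    define r where "r = (nrm u)\<^sup>2"
    have r: "0 < r" unfolding r_def by (intro zero_less_power nrm_pos False)
    have uu: "ip (J u) u = complex_of_real r" by (simp add: ip_J_self r_def)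
    have vu: "ip (J v) u = cnj a"
      unfolding a_def using ip_commute[of "J u" v] by (simp add: ip_J_commute)
    \<comment> \<open>The component of \<open>v\<close> orthogonal to \<open>u\<close>, multiplied by \<open>r\<close> to avoid a division.\<close>
    define w where "w = s (complex_of_real r) v - s (cnj a) u"
    have Jw: "J w = s (complex_of_real r) (J v) - s (cnj a) (J u)"
      by (simp add: w_def J_diff J_scale)
    have "ip (J w) w = complex_of_real r * complex_of_real r * ip (J v) v
        - complex_of_real r * (a * cnj a)"
      unfolding Jw unfolding w_def
      by (simp add: ip_diff_left ip_diff_right ip_scale_left ip_scale_right uu vu
          a_def[symmetric] algebra_simps)
    also have "\<dots> = complex_of_real (r * (r * (nrm v)\<^sup>2 - (cmod a)\<^sup>2))"
      by (simp only: complex_norm_square[symmetric] ip_J_self of_real_mult of_real_diff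
          right_diff_distrib mult.assoc)
    finally have "(nrm w)\<^sup>2 = r * (r * (nrm v)\<^sup>2 - (cmod a)\<^sup>2)"
      by (simp only: nrm_sq Re_complex_of_real)
    then have "0 \<le> r * (r * (nrm v)\<^sup>2 - (cmod a)\<^sup>2)"
      by (metis zero_le_power2)
    then have "(cmod a)\<^sup>2 \<le> (nrm u * nrm v)\<^sup>2"
      using r by (simp add: zero_le_mult_iff power_mult_distrib r_def)
    then show ?thesis
      unfolding a_def by (rule power2_le_imp_le) simp
  qed (simp add: J_eq[of 0 0, simplified] subspace_0 subspace_P subspace_N)
  show ?thesis
    using main[of "J x" y] by simp
qed

lemma nrm_add: "nrm (x + y) \<le> nrm x + nrm y"
proof (rule power2_le_imp_le)
  have "(nrm (x + y))\<^sup>2 = (nrm x)\<^sup>2 + (nrm y)\<^sup>2 + Re (ip (J x) y) + Re (ip (J y) x)"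
    by (simp add: nrm_sq J_add ip_add_left ip_add_right)
  moreover have "Re (ip (J x) y) \<le> nrm x * nrm y" "Re (ip (J y) x) \<le> nrm x * nrm y"
    using Cauchy_Schwarz_ip[of "J x" y] Cauchy_Schwarz_ip[of "J y" x]
      complex_Re_le_cmod[of "ip (J x) y"] complex_Re_le_cmod[of "ip (J y) x"]
    by (simp_all add: mult.commute)
  ultimately show "(nrm (x + y))\<^sup>2 \<le> (nrm x + nrm y)\<^sup>2"
    by (simp add: power2_sum)
qed simp

lemma nrm_decomposed:
  assumes "p \<in> P" "n \<in> N"
  shows "(nrm (p + n))\<^sup>2 = (nrm p)\<^sup>2 + (nrm n)\<^sup>2"
  using ip_J_decomposed[OF assms] ip_J_decomposed[OF assms(1) subspace_0[OF subspace_N]]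
    ip_J_decomposed[OF subspace_0[OF subspace_P] assms(2)]
  by (simp add: nrm_sq)

lemma nrm_component_le:
  assumes "p \<in> P" "n \<in> N"
  shows "nrm p \<le> nrm (p + n)" "nrm n \<le> nrm (p + n)"
  using nrm_decomposed[OF assms] by (simp_all add: power2_le_imp_le)

lemma form_dist_eq:
  assumes "x - y \<in> P \<union> N"
  shows "form_dist ip x y = nrm (x - y)"
proof -
  have "cmod (ip (x - y) (x - y)) = (nrm (x - y))\<^sup>2"
  proof (cases "x - y \<in> P")
    case True
    then have "J (x - y) = x - y"
      using J_eq[of "x - y" 0] subspace_0[OF subspace_N] by simp
    with ip_J_self[of "x - y"] show ?thesis
      by (simp add: norm_power)
  next
    case False
    with assms have "J (x - y) = - (x - y)"
      using J_eq[of 0 "x - y"] subspace_0[OF subspace_P] by simp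
    with ip_J_self[of "x - y"] have "- ip (x - y) (x - y) = complex_of_real ((nrm (x - y))\<^sup>2)"
      by (simp only: ip_minus_left)
    then have "cmod (- ip (x - y) (x - y)) = (nrm (x - y))\<^sup>2"
      by (simp add: norm_power)
    then show ?thesis
      by simp
  qed
  then show ?thesis
    by (simp add: form_dist_def)
qed

sublocale hilbert: Metric_space UNIV "\<lambda>x y. nrm (x - y)"
proof
  fix x y z :: 'a
  show "nrm (x - y) = nrm (y - x)"
    using nrm_minus[of "x - y"] by simp
  show "nrm (x - z) \<le> nrm (x - y) + nrm (y - z)"
    using nrm_add[of "x - y" "y - z"] by simp
qed auto

lemma hilbert_topology_eq: "hilbert_topology ip P N = hilbert.mtopology"
  by (simp add: hilbert_topology_def)

text \<open>
  On either summand the distance of the definite form is the Hilbert space distance, so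
  completeness of the summand for the former gives a limit for the latter.
\<close>

lemma Cauchy_in_summand_converges:
  assumes Q: "Q = P \<or> Q = N" and "range \<sigma> \<subseteq> Q" and "hilbert.MCauchy \<sigma>"
  shows "\<exists>l\<in>Q. limitin hilbert.mtopology \<sigma> l sequentially"
proof -
  have sub: "subspace Q"
    using Q subspace_P subspace_N by blast
  have eq: "form_dist ip x y = nrm (x - y)" if "x \<in> Q" "y \<in> Q" for x y
    using form_dist_eq[of x y] subspace_diff[OF sub that] Q by blast
  have \<sigma>: "\<sigma> i \<in> Q" for i
    using assms(2) by auto
  interpret form: Metric_space Q "form_dist ip"
  proof
    fix x y
    show "form_dist ip x y = form_dist ip y x"
      unfolding form_dist_def using ip_minus_left[of "x - y"] ip_minus_right[of "x - y" "x - y"]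
      by (metis add.inverse_inverse ip_minus_left ip_minus_right minus_diff_eq)
  next
    fix x y z assume "x \<in> Q" "y \<in> Q" "z \<in> Q"
    then show "form_dist ip x z \<le> form_dist ip x y + form_dist ip y z"
      by (simp add: eq hilbert.triangle)
  next
    fix x y assume "x \<in> Q" "y \<in> Q"
    then show "form_dist ip x y = 0 \<longleftrightarrow> x = y"
      by (simp add: eq)
  qed (simp add: form_dist_def)
  have "form.MCauchy \<sigma>"
    using assms(2,3) by (simp add: form.MCauchy_def hilbert.MCauchy_def eq \<sigma>)
  moreover have "form.mcomplete"
    using Q mcomplete_P mcomplete_N by blast
  ultimately obtain l where l: "limitin form.mtopology \<sigma> l sequentially"
    unfolding form.mcomplete_def by blast
  then have "l \<in> Q"
    by (simp add: form.limitin_metric)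
  with l have "limitin hilbert.mtopology \<sigma> l sequentially"
    by (simp add: form.limitin_metric hilbert.limitin_metric eq \<sigma>)
  with \<open>l \<in> Q\<close> show ?thesis by blast
qed

text \<open>
  The projections onto \<open>P\<close> and \<open>N\<close> do not increase the norm, so both components of a Cauchy
  sequence are Cauchy.
\<close>

lemma mcomplete_hilbert: "hilbert.mcomplete"
  unfolding hilbert.mcomplete_def
proof (intro allI impI)
  fix \<sigma> assume \<sigma>: "hilbert.MCauchy \<sigma>"
  have "\<exists>p n. p \<in> P \<and> n \<in> N \<and> \<sigma> i = p + n" for i
    using decomposeE[of "\<sigma> i"] by metis
  then obtain p n where pn: "\<And>i. p i \<in> P" "\<And>i. n i \<in> N" "\<And>i. \<sigma> i = p i + n i"
    by metis
  have comp: "nrm (p i - p j) \<le> nrm (\<sigma> i - \<sigma> j)" "nrm (n i - n j) \<le> nrm (\<sigma> i - \<sigma> j)" for i j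
    using nrm_component_le[of "p i - p j" "n i - n j"] subspace_diff[OF subspace_P, of "p i" "p j"]
      subspace_diff[OF subspace_N, of "n i" "n j"] pn(1,2)
    by (simp_all add: pn(3) algebra_simps)
  have "hilbert.MCauchy p" "hilbert.MCauchy n"
    using \<sigma> comp unfolding hilbert.MCauchy_def by (meson le_less_trans subset_UNIV)+
  then obtain a b where ab: "limitin hilbert.mtopology p a sequentially"
      "limitin hilbert.mtopology n b sequentially"
    using Cauchy_in_summand_converges[of P p] Cauchy_in_summand_converges[of N n] pn by blast
  have "(\<lambda>i. nrm (p i - a) + nrm (n i - b)) \<longlonglongrightarrow> 0 + 0"
    using ab by (intro tendsto_add) (simp_all add: hilbert.limitin_metric_dist_null)
  moreover have "nrm (\<sigma> i - (a + b)) \<le> nrm (p i - a) + nrm (n i - b)" for i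
    using nrm_add[of "p i - a" "n i - b"] by (simp add: pn(3) algebra_simps)
  ultimately have "(\<lambda>i. nrm (\<sigma> i - (a + b))) \<longlonglongrightarrow> 0"
    by (intro tendsto_sandwich[OF _ _ tendsto_const, of _ "\<lambda>i. nrm (\<sigma> i - (a + b))" _
          "\<lambda>i. nrm (p i - a) + nrm (n i - b)"]) auto
  then show "\<exists>x. limitin hilbert.mtopology \<sigma> x sequentially"
    by (auto simp: hilbert.limitin_metric_dist_null)
qed

section \<open>Uniform boundedness and dense subspaces\<close>

lemma closedin_ip_bounded:
  assumes "closedin hilbert.mtopology D"
  shows "closedin hilbert.mtopology {x \<in> D. \<forall>z\<in>B. cmod (ip x z) \<le> r}"
  unfolding hilbert.metric_closedin_iff_sequentially_closed
proof (intro conjI allI impI)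
  fix \<sigma> l
  assume "range \<sigma> \<subseteq> {x \<in> D. \<forall>z\<in>B. cmod (ip x z) \<le> r} \<and> limitin hilbert.mtopology \<sigma> l sequentially"
  then have \<sigma>: "\<And>i. \<sigma> i \<in> D" "\<And>i z. z \<in> B \<Longrightarrow> cmod (ip (\<sigma> i) z) \<le> r"
    and l: "limitin hilbert.mtopology \<sigma> l sequentially"
    by auto
  have "l \<in> D"
    using assms \<sigma>(1) l unfolding hilbert.metric_closedin_iff_sequentially_closed by blast
  moreover have "cmod (ip l z) \<le> r" if "z \<in> B" for z
  proof -
    have "cmod (ip l z) \<le> r + nrm (\<sigma> i - l) * nrm z" for i
      using norm_triangle_ineq4[of "ip (\<sigma> i) z" "ip (\<sigma> i - l) z"] \<sigma>(2)[OF that, of i]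
        Cauchy_Schwarz_ip[of "\<sigma> i - l" z] by (simp add: ip_diff_left)
    moreover have "(\<lambda>i. r + nrm (\<sigma> i - l) * nrm z) \<longlonglongrightarrow> r + 0 * nrm z"
      using l by (intro tendsto_intros) (simp add: hilbert.limitin_metric_dist_null)
    ultimately show ?thesis
      by (intro LIMSEQ_le_const[of _ r]) auto
  qed
  ultimately show "l \<in> {x \<in> D. \<forall>z\<in>B. cmod (ip x z) \<le> r}"
    by blast
qed auto

text \<open>
  The Banach--Steinhaus theorem for the functionals \<open>\<lambda>x. ip x z\<close> with \<open>z \<in> B\<close>, by the Baire category
  argument: the complete space \<open>D\<close> is the union of the closed sets on which all functionals are
  bounded by a natural number \<open>k\<close>, so one of these sets contains a ball.
\<close>

lemma uniform_boundedness:
  assumes D: "subspace D" and cl: "closedin hilbert.mtopology D"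
    and pw: "\<And>x. x \<in> D \<Longrightarrow> \<exists>K. \<forall>z\<in>B. cmod (ip x z) \<le> K"
  shows "\<exists>C\<ge>0. \<forall>x\<in>D. \<forall>z\<in>B. cmod (ip x z) \<le> C * nrm x"
proof -
  interpret D: Submetric UNIV "\<lambda>x y. nrm (x - y)" D
    by unfold_locales simp
  define A where "A k = {x \<in> D. \<forall>z\<in>B. cmod (ip x z) \<le> real k}" for k
  have clA: "closedin D.sub.mtopology (A k)" for k
    unfolding D.mtopology_submetric A_def
    by (rule closedin_subset_topspace[OF closedin_ip_bounded[OF cl]]) blast
  have "\<Union>(range A) = D"
  proof
    show "D \<subseteq> \<Union>(range A)"
    proof
      fix x assume "x \<in> D"
      with pw obtain K where K: "\<forall>z\<in>B. cmod (ip x z) \<le> K" by blast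
      obtain k :: nat where "K \<le> real k" using real_arch_simple by blast
      with K \<open>x \<in> D\<close> have "x \<in> A k" unfolding A_def by force
      then show "x \<in> \<Union>(range A)" by blast
    qed
  qed (auto simp: A_def)
  moreover have "0 \<in> D" using D by (rule subspace_0)
  ultimately have "D.sub.mtopology interior_of \<Union>(range A) \<noteq> {}"
    using interior_of_topspace[of D.sub.mtopology] by auto
  moreover have "D.sub.mtopology interior_of \<Union>(range A) = {}"
    if "\<And>k. D.sub.mtopology interior_of A k = {}"
    using D.closedin_mcomplete_imp_mcomplete[OF cl mcomplete_hilbert] clA that
    by (intro D.sub.metric_Baire_category_alt) auto
  ultimately obtain k where "D.sub.mtopology interior_of A k \<noteq> {}"
    by blast
  then obtain x0 where x0: "x0 \<in> D.sub.mtopology interior_of A k"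
    by blast
  moreover have "openin D.sub.mtopology (D.sub.mtopology interior_of A k)"
    by simp
  ultimately obtain r where r: "0 < r" "D.sub.mball x0 r \<subseteq> D.sub.mtopology interior_of A k"
    unfolding D.sub.openin_mtopology by blast
  have x0D: "x0 \<in> A k" "x0 \<in> D"
    using x0 interior_of_subset[of D.sub.mtopology "A k"] by (auto simp: A_def)
  \<comment> \<open>Differences with the centre move the ball to the origin, at the price of a factor 2.\<close>
  have small: "cmod (ip x z) \<le> 2 * real k" if "x \<in> D" "nrm x < r" "z \<in> B" for x z
  proof -
    have "x0 - (x0 + x) = - x" by simp
    then have "x0 + x \<in> D.sub.mball x0 r"
      using that x0D subspace_add[OF D x0D(2) that(1)] nrm_minus[of x] by simp
    then have "x0 + x \<in> A k"
      using r interior_of_subset[of D.sub.mtopology "A k"] by blast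
    with x0D that(3) have "cmod (ip (x0 + x) z) \<le> real k" "cmod (ip x0 z) \<le> real k"
      by (auto simp: A_def)
    then show ?thesis
      using norm_triangle_ineq4[of "ip (x0 + x) z" "ip x0 z"] by (simp add: ip_add_left)
  qed
  show ?thesis
  proof (intro exI conjI ballI)
    \<comment> \<open>Vectors are rescaled to norm \<open>r / 2\<close>, inside the open ball; hence 4 instead of 2.\<close>
    show "0 \<le> 4 * real k / r" using r by simp
    fix x z assume x: "x \<in> D" and z: "z \<in> B"
    show "cmod (ip x z) \<le> 4 * real k / r * nrm x"
    proof (cases "x = 0")
      case False
      define t where "t = r / (2 * nrm x)"
      have t: "0 < t" "t * nrm x < r" using r nrm_pos[OF False] by (simp_all add: t_def)
      have "cmod (ip (s (complex_of_real t) x) z) \<le> 2 * real k"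
        using t x z by (intro small subspace_scale D) (simp_all add: nrm_scale)
      then have "t * cmod (ip x z) \<le> 2 * real k"
        using t by (simp add: ip_scale_left norm_mult)
      then show ?thesis
        using r nrm_pos[OF False] by (simp add: t_def field_simps)
    qed simp
  qed
qed

lemma dense_approx:
  assumes "hilbert.mtopology closure_of R = UNIV" "0 < e"
  obtains y' where "y' \<in> R" "nrm (y - y') < e"
  using assms unfolding hilbert.metric_closure_of by (auto simp: set_eq_iff)

text \<open>
  The Hilbert norm of \<open>v\<close> is attained by testing the indefinite form against \<open>J v\<close>; by
  continuity, a dense subspace provides enough test vectors.
\<close>

lemma nrm_le_by_dense:
  assumes R: "subspace R" and dense: "hilbert.mtopology closure_of R = UNIV"
    and bd: "\<And>y. y \<in> R \<Longrightarrow> nrm y \<le> 1 \<Longrightarrow> cmod (ip v y) \<le> c"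
  shows "nrm v \<le> c"
proof (cases "v = 0")
  case True
  then show ?thesis
    using bd[of 0] subspace_0[OF R] by simp
next
  case False
  have c: "0 \<le> c"
    using bd[of 0] subspace_0[OF R] by simp
  have bd': "cmod (ip v y) \<le> c * nrm y" if "y \<in> R" for y
  proof (cases "y = 0")
    case False
    define t where "t = inverse (nrm y)"
    have t: "0 < t" "t * nrm y = 1" using nrm_pos[OF False] False by (simp_all add: t_def)
    have "cmod (ip v (s (complex_of_real t) y)) \<le> c"
      using t that by (intro bd subspace_scale R) (simp_all add: nrm_scale)
    then have "t * cmod (ip v y) \<le> c"
      using t by (simp add: ip_scale_right norm_mult)
    then show ?thesis
      using nrm_pos[OF False] by (simp add: t_def field_simps)
  qed simp
  have "nrm v * nrm v \<le> c * nrm v + e" if e: "0 < e" for e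
  proof -
    \<comment> \<open>Replacing \<open>J v\<close> by a vector of \<open>R\<close> at distance \<open>d\<close> costs at most \<open>(c + nrm v) * d\<close>.\<close>
    define d where "d = e / (c + nrm v)"
    have d: "0 < d" "(c + nrm v) * d = e"
      using e c nrm_pos[OF False] by (simp_all add: d_def)
    obtain y where y: "y \<in> R" "nrm (J v - y) < d"
      using dense_approx[OF dense d(1)] by blast
    have "nrm v * nrm v = cmod (ip v (J v))"
      using ip_J_self[of v] by (simp add: ip_J_commute norm_mult power2_eq_square)
    also have "\<dots> \<le> cmod (ip v y) + cmod (ip v (J v - y))"
      using norm_triangle_ineq[of "ip v y" "ip v (J v - y)"] by (simp add: ip_diff_right)
    also have "\<dots> \<le> c * nrm y + nrm v * nrm (J v - y)"
      using bd'[OF y(1)] Cauchy_Schwarz_ip[of v "J v - y"] by simp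
    also have "\<dots> \<le> c * (nrm v + d) + nrm v * d"
    proof (intro add_mono mult_left_mono c)
      have "nrm y \<le> nrm (J v) + nrm (y - J v)"
        using nrm_add[of "J v" "y - J v"] by simp
      also have "nrm (y - J v) = nrm (J v - y)"
        by (rule hilbert.commute)
      finally show "nrm y \<le> nrm v + d"
        using y(2) by simp
    qed (use y(2) in auto)
    finally show ?thesis
      using d(2) by (simp add: algebra_simps)
  qed
  then have "nrm v * nrm v \<le> c * nrm v"
    by (rule field_le_epsilon)
  then show ?thesis
    using nrm_pos[OF False] by simp
qed

end

section \<open>Isometric relations\<close>

locale isometric_relation =
  X: decomposed_krein_space sX ipX XP XN + Y: decomposed_krein_space sY ipY YP YN
  for sX :: "complex \<Rightarrow> 'a::ab_group_add \<Rightarrow> 'a" and ipX XP XN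
    and sY :: "complex \<Rightarrow> 'b::ab_group_add \<Rightarrow> 'b" and ipY YP YN +
  fixes V :: "('a \<times> 'b) set"
  assumes linear: "linear_relation sX sY V" and isometric: "isometric_rel ipX ipY V"
begin

sublocale prod: module_prod sX sY
  by unfold_locales

lemma subspace_V: "prod.p.subspace V"
  using linear by (simp add: linear_relation_def)

lemma zero_V: "(0, 0) \<in> V"
  using prod.p.subspace_0[OF subspace_V] by (simp add: zero_prod_def)

lemma diff_V: "(x, y) \<in> V \<Longrightarrow> (x', y') \<in> V \<Longrightarrow> (x - x', y - y') \<in> V"
  using prod.p.subspace_diff[OF subspace_V, of "(x, y)" "(x', y')"] by simp

lemma add_V: "(x, y) \<in> V \<Longrightarrow> (x', y') \<in> V \<Longrightarrow> (x + x', y + y') \<in> V"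
  using prod.p.subspace_add[OF subspace_V, of "(x, y)" "(x', y')"] by simp

lemma scale_V: "(x, y) \<in> V \<Longrightarrow> (sX c x, sY c y) \<in> V"
  using prod.p.subspace_scale[OF subspace_V, of "(x, y)" c] by (simp add: prod.scale_prod)

lemma ip_V: "(x, y) \<in> V \<Longrightarrow> (x', y') \<in> V \<Longrightarrow> ipX x x' = ipY y y'"
  using isometric unfolding isometric_rel_def adjoint_rel_def by blast

lemma subspace_Domain: "X.subspace (Domain V)"
  unfolding X.subspace_def using zero_V add_V scale_V by blast

lemma subspace_Range: "Y.subspace (Range V)"
  unfolding Y.subspace_def using zero_V add_V scale_V by blast

lemma isometric_relation_converse: "isometric_relation sY ipY YP YN sX ipX XP XN (V\<inverse>)"
proof -
  interpret conv: module_prod sY sX by unfold_locales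
  have "conv.p.subspace (V\<inverse>)"
    unfolding conv.p.subspace_def using zero_V add_V scale_V
    by (auto simp: zero_prod_def conv.scale_prod)
  moreover have "isometric_rel ipY ipX (V\<inverse>)"
    unfolding isometric_rel_def adjoint_rel_def by (auto simp: ip_V)
  ultimately show ?thesis
    unfolding linear_relation_def[symmetric]
    by (intro isometric_relation.intro isometric_relation_axioms.intro
        X.decomposed_krein_space_axioms Y.decomposed_krein_space_axioms)
qed

text \<open>
  Isometry says that pairing \<open>x\<close> with the domain and \<open>y\<close> with the range gives the same values.
\<close>

lemma isotropic_iff:
  assumes "(x, y) \<in> V"
  shows "x \<in> isotropic_part ipX (Domain V) \<longleftrightarrow> y \<in> isotropic_part ipY (Range V)"
proof -
  have "x \<in> Domain V" "y \<in> Range V"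
    using assms by blast+
  moreover have "(\<forall>a\<in>Domain V. ipX x a = 0) \<longleftrightarrow> (\<forall>(a, b)\<in>V. ipX x a = 0)"
    by blast
  moreover have "(\<forall>b\<in>Range V. ipY y b = 0) \<longleftrightarrow> (\<forall>(a, b)\<in>V. ipY y b = 0)"
    by blast
  moreover have "(\<forall>(a, b)\<in>V. ipX x a = 0) \<longleftrightarrow> (\<forall>(a, b)\<in>V. ipY y b = 0)"
    by (rule ball_cong) (auto simp: ip_V[OF assms])
  ultimately show ?thesis
    by (simp add: isotropic_part_def orth_companion_def)
qed

lemma mul_subset_isotropic: "mul_rel V \<subseteq> isotropic_part ipY (Range V)"
proof
  fix y assume "y \<in> mul_rel V"
  then have "(0, y) \<in> V"
    by (simp add: mul_rel_def)
  moreover have "0 \<in> isotropic_part ipX (Domain V)"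
    using zero_V by (auto simp: isotropic_part_def orth_companion_def)
  ultimately show "y \<in> isotropic_part ipY (Range V)"
    using isotropic_iff by blast
qed

lemma mul_isotropic_if_ker_isotropic:
  assumes "isotropic_part ipX (Domain V) = ker_rel V"
  shows "isotropic_part ipY (Range V) = mul_rel V"
proof
  show "isotropic_part ipY (Range V) \<subseteq> mul_rel V"
  proof
    fix y assume y: "y \<in> isotropic_part ipY (Range V)"
    then obtain x where xy: "(x, y) \<in> V"
      by (auto simp: isotropic_part_def)
    with y assms have "(x, 0) \<in> V"
      using isotropic_iff[OF xy] by (auto simp: ker_rel_def)
    with xy show "y \<in> mul_rel V"
      using diff_V by (fastforce simp: mul_rel_def)
  qed
qed (rule mul_subset_isotropic)

text \<open>
  Vectors of the multivalued part are orthogonal to the range, so testing against a dense range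
  shows that their norm is zero.
\<close>

lemma is_operator_if_dense_Range:
  assumes "Y.hilbert.mtopology closure_of Range V = UNIV"
  shows "is_operator V"
proof -
  have "v = 0" if "v \<in> mul_rel V" for v
  proof -
    have "ipY v y = 0" if "y \<in> Range V" for y
      using \<open>v \<in> mul_rel V\<close> mul_subset_isotropic that
      by (auto simp: isotropic_part_def orth_companion_def)
    then have "Y.nrm v \<le> 0"
      by (intro Y.nrm_le_by_dense[OF subspace_Range assms]) simp
    then show "v = 0"
      using Y.nrm_pos[of v] by fastforce
  qed
  then show ?thesis
    using zero_V by (auto simp: is_operator_def mul_rel_def)
qed

text \<open>
  The test vectors \<open>w\<close> for \<open>\<parallel>y\<parallel>\<close> are taken from the range; isometry moves them to vectors \<open>z\<close> of
  the domain, which form a pointwise bounded family of functionals although the \<open>z\<close> themselves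
  need not be bounded.
\<close>

lemma bounded_if_closed_Domain:
  assumes cl: "closedin X.hilbert.mtopology (Domain V)"
    and dense: "Y.hilbert.mtopology closure_of Range V = UNIV"
  shows "\<exists>C\<ge>0. \<forall>(x, y)\<in>V. Y.nrm y \<le> C * X.nrm x"
proof -
  define B where "B = {z. \<exists>w. (z, w) \<in> V \<and> Y.nrm w \<le> 1}"
  have "\<exists>K. \<forall>z\<in>B. cmod (ipX x z) \<le> K" if "x \<in> Domain V" for x
  proof -
    from that obtain y where xy: "(x, y) \<in> V"
      by blast
    have "cmod (ipX x z) \<le> Y.nrm y" if "z \<in> B" for z
    proof -
      from that obtain w where w: "(z, w) \<in> V" "Y.nrm w \<le> 1"
        by (auto simp: B_def)
      have "cmod (ipX x z) \<le> Y.nrm y * Y.nrm w"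
        using ip_V[OF xy w(1)] Y.Cauchy_Schwarz_ip[of y w] by simp
      also have "\<dots> \<le> Y.nrm y"
        using w(2) by (simp add: mult_left_le)
      finally show ?thesis .
    qed
    then show ?thesis by blast
  qed
  from X.uniform_boundedness[OF subspace_Domain cl this]
  obtain C where C: "0 \<le> C" "\<forall>x\<in>Domain V. \<forall>z\<in>B. cmod (ipX x z) \<le> C * X.nrm x"
    by blast
  have "Y.nrm y \<le> C * X.nrm x" if xy: "(x, y) \<in> V" for x y
  proof (rule Y.nrm_le_by_dense[OF subspace_Range dense])
    fix w assume "w \<in> Range V" "Y.nrm w \<le> 1"
    then obtain z where z: "(z, w) \<in> V" "z \<in> B"
      by (auto simp: B_def)
    have "cmod (ipX x z) \<le> C * X.nrm x"
      using C(2) DomainI[OF xy] z(2) by blast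
    then show "cmod (ipY y w) \<le> C * X.nrm x"
      by (simp only: ip_V[OF xy z(1)])
  qed
  then have "\<forall>(x, y)\<in>V. Y.nrm y \<le> C * X.nrm x"
    by blast
  with C(1) show ?thesis
    by (intro exI[of _ C] conjI)
qed

text \<open>
  Comparing \<open>x\<close> with \<open>J x\<close>, which lies in the domain as well, shows that \<open>V\<close> is bounded below.
  Preimages of a Cauchy sequence in the range are therefore Cauchy, and the range is closed.
\<close>

lemma Range_UNIV_if_Domain_UNIV:
  assumes dom: "Domain V = UNIV"
    and dense: "Y.hilbert.mtopology closure_of Range V = UNIV"
  shows "Range V = UNIV"
proof -
  have cl: "closedin X.hilbert.mtopology (Domain V)"
    using X.hilbert.closedin_mspace by (simp add: dom)
  obtain C where C: "0 \<le> C" "\<And>x y. (x, y) \<in> V \<Longrightarrow> Y.nrm y \<le> C * X.nrm x"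
    using bounded_if_closed_Domain[OF cl dense] by blast
  have below: "X.nrm x \<le> C * Y.nrm y" if xy: "(x, y) \<in> V" for x y
  proof (cases "x = 0")
    case False
    obtain w where w: "(X.J x, w) \<in> V"
      using dom by blast
    have "X.nrm x * X.nrm x = cmod (ipX x (X.J x))"
      using X.ip_J_self[of x] by (simp add: X.ip_J_commute norm_mult power2_eq_square)
    also have "\<dots> \<le> Y.nrm y * Y.nrm w"
      using ip_V[OF xy w] Y.Cauchy_Schwarz_ip[of y w] by simp
    also have "\<dots> \<le> Y.nrm y * (C * X.nrm x)"
      using C(2)[OF w] by (simp add: mult_left_mono)
    finally have "X.nrm x * X.nrm x \<le> (C * Y.nrm y) * X.nrm x"
      by (simp add: algebra_simps)
    then show ?thesis
      using X.nrm_pos[OF False] by simp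
  qed (simp add: C(1))
  have "y \<in> Range V" for y
  proof -
    have "y \<in> Y.hilbert.mtopology closure_of Range V"
      using dense by simp
    then obtain \<tau> where \<tau>: "range \<tau> \<subseteq> Range V" "limitin Y.hilbert.mtopology \<tau> y sequentially"
      unfolding Y.hilbert.closure_of_sequentially by blast
    have "\<exists>x. (x, \<tau> i) \<in> V" for i
      using \<tau>(1) by blast
    then obtain \<sigma> where \<sigma>: "\<And>i. (\<sigma> i, \<tau> i) \<in> V"
      by metis
    have "Y.hilbert.MCauchy \<tau>"
      using Y.hilbert.convergent_imp_MCauchy[OF _ \<tau>(2)] by simp
    have "X.hilbert.MCauchy \<sigma>"
      unfolding X.hilbert.MCauchy_def
    proof (intro conjI allI impI)
      fix e :: real assume e: "0 < e"
      have "0 < e / (C + 1)" using e C(1) by simp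
      then obtain k where k: "\<And>i j. k \<le> i \<Longrightarrow> k \<le> j \<Longrightarrow> Y.nrm (\<tau> i - \<tau> j) < e / (C + 1)"
        using \<open>Y.hilbert.MCauchy \<tau>\<close> unfolding Y.hilbert.MCauchy_def by blast
      have "X.nrm (\<sigma> i - \<sigma> j) < e" if "k \<le> i" "k \<le> j" for i j
      proof -
        have "X.nrm (\<sigma> i - \<sigma> j) \<le> C * Y.nrm (\<tau> i - \<tau> j)"
          by (intro below diff_V \<sigma>)
        also have "\<dots> \<le> (C + 1) * Y.nrm (\<tau> i - \<tau> j)"
          by (simp add: mult_right_mono)
        also have "\<dots> < e"
          using k[OF that] C(1) by (simp add: field_simps)
        finally show ?thesis .
      qed
      then show "\<exists>k. \<forall>i j. k \<le> i \<longrightarrow> k \<le> j \<longrightarrow> X.nrm (\<sigma> i - \<sigma> j) < e"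
        by blast
    qed simp
    then obtain x where x: "limitin X.hilbert.mtopology \<sigma> x sequentially"
      using X.mcomplete_hilbert unfolding X.hilbert.mcomplete_def by blast
    obtain w where w: "(x, w) \<in> V"
      using dom by blast
    have "Y.nrm (\<tau> i - w) \<le> C * X.nrm (\<sigma> i - x)" for i
      by (intro C(2) diff_V \<sigma> w)
    moreover have "(\<lambda>i. C * X.nrm (\<sigma> i - x)) \<longlonglongrightarrow> C * 0"
      using x by (intro tendsto_intros) (simp add: X.hilbert.limitin_metric_dist_null)
    ultimately have "(\<lambda>i. Y.nrm (\<tau> i - w)) \<longlonglongrightarrow> 0"
      by (intro tendsto_sandwich[OF _ _ tendsto_const, of _ "\<lambda>i. Y.nrm (\<tau> i - w)" _
            "\<lambda>i. C * X.nrm (\<sigma> i - x)"]) auto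
    then have "limitin Y.hilbert.mtopology \<tau> w sequentially"
      by (simp add: Y.hilbert.limitin_metric_dist_null)
    then have "y = w"
      using Y.hilbert.limitin_metric_unique[OF \<tau>(2)] by simp
    with w show ?thesis by blast
  qed
  then show ?thesis by blast
qed

lemma standard_unitary_if_dense_Range:
  assumes "Domain V = UNIV" "Y.hilbert.mtopology closure_of Range V = UNIV"
  shows "standard_unitary sX ipX sY ipY V"
  unfolding standard_unitary_def
  using linear isometric is_operator_if_dense_Range Range_UNIV_if_Domain_UNIV assms by blast

end

theorem proposition4p1:
  fixes sX :: "complex \<Rightarrow> 'a::ab_group_add \<Rightarrow> 'a"
    and ipX :: "'a \<Rightarrow> 'a \<Rightarrow> complex"
    and sY :: "complex \<Rightarrow> 'b::ab_group_add \<Rightarrow> 'b"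
    and ipY :: "'b \<Rightarrow> 'b \<Rightarrow> complex"
    and XP XN :: "'a set" and YP YN :: "'b set"
    and V :: "('a \<times> 'b) set"
  assumes "krein_space sX ipX" and "krein_space sY ipY"
    and "fundamental_decomposition sX ipX XP XN"
    and "fundamental_decomposition sY ipY YP YN"
    and "linear_relation sX sY V" and "isometric_rel ipX ipY V"
  shows
    "(isotropic_part ipY (Range V) = mul_rel V \<longleftrightarrow> isotropic_part ipX (Domain V) = ker_rel V) \<and>
     (closedin (hilbert_topology ipX XP XN) (Domain V) \<and>
      hilbert_topology ipY YP YN closure_of Range V = UNIV \<longrightarrow>
        bounded_operator (hilbert_norm ipX XP XN) (hilbert_norm ipY YP YN) V) \<and>
     ((hilbert_topology ipX XP XN closure_of Domain V = UNIV \<and> Range V = UNIV) \<or>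
      (hilbert_topology ipY YP YN closure_of Range V = UNIV \<and> Domain V = UNIV) \<longrightarrow>
        standard_unitary sX ipX sY ipY V)"
proof -
  interpret X: krein_space sX ipX by fact
  interpret Y: krein_space sY ipY by fact
  interpret V: isometric_relation sX ipX XP XN sY ipY YP YN V
    by unfold_locales (fact assms)+
  interpret W: isometric_relation sY ipY YP YN sX ipX XP XN "V\<inverse>"
    by (rule V.isometric_relation_converse)
  have conv: "ker_rel (V\<inverse>) = mul_rel V" "mul_rel (V\<inverse>) = ker_rel V"
    by (auto simp: ker_rel_def mul_rel_def)
  have i: "isotropic_part ipY (Range V) = mul_rel V \<longleftrightarrow> isotropic_part ipX (Domain V) = ker_rel V"
    using V.mul_isotropic_if_ker_isotropic W.mul_isotropic_if_ker_isotropic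
    by (auto simp: conv)
  have ii: "bounded_operator (hilbert_norm ipX XP XN) (hilbert_norm ipY YP YN) V"
    if cl: "closedin (hilbert_topology ipX XP XN) (Domain V)"
      and dense: "hilbert_topology ipY YP YN closure_of Range V = UNIV"
  proof -
    note hyps = cl[unfolded V.X.hilbert_topology_eq] dense[unfolded V.Y.hilbert_topology_eq]
    show ?thesis
      unfolding bounded_operator_def
      using V.bounded_if_closed_Domain[OF hyps] V.is_operator_if_dense_Range[OF hyps(2)] by blast
  qed
  have iii: "standard_unitary sX ipX sY ipY V"
    if "hilbert_topology ipY YP YN closure_of Range V = UNIV" "Domain V = UNIV"
    using that V.standard_unitary_if_dense_Range by (simp add: V.Y.hilbert_topology_eq)
  have iii': "standard_unitary sX ipX sY ipY V"
    if dense: "hilbert_topology ipX XP XN closure_of Domain V = UNIV" and ran: "Range V = UNIV"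
  proof -
    have "Domain V = UNIV"
      using W.Range_UNIV_if_Domain_UNIV dense ran by (simp add: V.X.hilbert_topology_eq)
    moreover have "hilbert_topology ipY YP YN closure_of Range V = UNIV"
      using closure_of_topspace[of V.Y.hilbert.mtopology] by (simp add: ran V.Y.hilbert_topology_eq)
    ultimately show ?thesis
      by (intro iii)
  qed
  show ?thesis
    using i ii iii iii' by blast
qed

end
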